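(* Fix $T>0$ and consider the channel $$Y(t)=\int_0^t g(s,W_0^s,Y_0^s)\,ds+B(t),\qquad t\in[0,T],$$ where $B$ is a standard Brownian motion, $W=\{W(t):t\in[0,T]\}$ is a process with paths in $C[0,T]$ independent of $B$, and $g:[0,T]\times C[0,T]\times C[0,T]\to\mathbb{R}$. Assume: (a) the solution $\{Y(t)\}$ of this stochastic differential equation uniquely exists; (b) $\mathbb{P}\left(\int_0^T g^2(t,W_0^t,Y_0^t)\,dt<\infty\right)=\mathbb{P}\left(\int_0^T g^2(t,W_0^t,B_0^t)\,dt<\infty\right)=1$; (c) $\int_0^T\mathbb{E}[|g(t,W_0^t,Y_0^t)|]\,dt<\infty$. For each $n\in\mathbb{N}$ let $\Delta_n=\{t_{n,0},t_{n,1},\dots,t_{n,n}\}$ with $0=t_{n,0}<t_{n,1}<\cdots<t_{n,n}=T$, and let $\delta_{\Delta_n}=\max_{1\le i\le n}(t_{n,i}-t_{n,i-1})$. Suppose $\Delta_n\subset\Delta_{n+1}$ for all $n$ and $\delta_{\Delta_n}\to0$ as $n\to\infty$. Then $$\lim_{n\to\infty}I(W_0^T;Y(\Delta_n))=I(W_0^T;Y_0^T),$$ where $Y(\Delta_n)=\{Y(t_{n,0}),Y(t_{n,1}),\dots,Y(t_{n,n})\}$.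
   Context: For a path or process $U$ and $0\le s\le T$, $U_0^s$ denotes $\{U(r):0\le r\le s\}$. When $U_0^s$ is used as an argument of $g$, it is regarded as an element of $C[0,T]$ by stopping the path at time $s$, so $g(s,W_0^s,Y_0^s)$ depends on $W$ and $Y$ only up to time $s$; $g$ is measurable. Mutual information: for random elements $U,V$ with laws $\mu_U,\mu_V$ and joint law $\mu_{UV}$, $I(U;V)=\mathbb{E}\left[\log\frac{d\mu_{UV}}{d(\mu_U\times\mu_V)}(U,V)\right]$ if the Radon–Nikodym derivative exists, and $I(U;V)=\infty$ otherwise. Here $W_0^T$, $Y_0^T$ are random elements of $C[0,T]$ and $Y(\Delta_n)$ is a random vector. *)

theory Defs
  imports "HOL-Probability.Probability"
begin

text \<open>
  The path space \<open>C[0,T]\<close>. A path is a function on the reals that takes the value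
  \<^term>\<open>undefined\<close> off \<open>[0,T]\<close> and is continuous on \<open>[0,T]\<close>. The sigma-algebra is generated by the
  evaluation maps; on \<open>C[0,T]\<close> this is the Borel sigma-algebra of the supremum norm.
\<close>

definition path_space :: "real \<Rightarrow> (real \<Rightarrow> real) measure" where
  "path_space T =
     restrict_space (Pi\<^sub>M {0..T} (\<lambda>_. borel)) {u. continuous_on {0..T} u}"

definition path_of :: "real \<Rightarrow> (real \<Rightarrow> 'a \<Rightarrow> real) \<Rightarrow> 'a \<Rightarrow> real \<Rightarrow> real" where
  "path_of T U \<omega> = (\<lambda>r\<in>{0..T}. U r \<omega>)"

text \<open>The path \<open>U\<^sub>0\<^sup>s\<close> as an element of \<open>C[0,T]\<close>: constant after time \<open>s\<close>.\<close>

definition stopped_path :: "real \<Rightarrow> real \<Rightarrow> (real \<Rightarrow> 'a \<Rightarrow> real) \<Rightarrow> 'a \<Rightarrow> real \<Rightarrow> real" where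
  "stopped_path T s U \<omega> = (\<lambda>r\<in>{0..T}. U (min r s) \<omega>)"

definition continuous_process :: "'a measure \<Rightarrow> real \<Rightarrow> (real \<Rightarrow> 'a \<Rightarrow> real) \<Rightarrow> bool" where
  "continuous_process M T U \<longleftrightarrow>
     (\<forall>t\<in>{0..T}. U t \<in> borel_measurable M) \<and>
     (\<forall>\<omega>\<in>space M. continuous_on {0..T} (\<lambda>t. U t \<omega>))"

definition standard_brownian_motion ::
  "'a measure \<Rightarrow> real \<Rightarrow> (real \<Rightarrow> 'a \<Rightarrow> real) \<Rightarrow> bool" where
  "standard_brownian_motion M T B \<longleftrightarrow>
     continuous_process M T B \<and>
     (AE \<omega> in M. B 0 \<omega> = 0) \<and>
     (\<forall>s t. 0 \<le> s \<and> s < t \<and> t \<le> T \<longrightarrow>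
        distributed M lborel (\<lambda>\<omega>. B t \<omega> - B s \<omega>)
          (\<lambda>x. ennreal (normal_density 0 (sqrt (t - s)) x))) \<and>
     (\<forall>(n::nat) t. 0 \<le> t 0 \<and> (\<forall>i<n. t i < t (Suc i)) \<and> t n \<le> T \<longrightarrow>
        prob_space.indep_vars M (\<lambda>_. borel)
          (\<lambda>i \<omega>. B (t (Suc i)) \<omega> - B (t i) \<omega>) {..<n})"

text \<open>
  The sigma-algebra at time \<open>t\<close> of the natural filtration of \<open>(W, B)\<close>, augmented by the null sets
  of \<open>M\<close>. Only measurable null sets are added, so that it remains a sub-sigma-algebra of \<open>M\<close> even if
  \<open>M\<close> is not complete.
\<close>

definition augmented_filtration ::
  "'a measure \<Rightarrow> (real \<Rightarrow> 'a \<Rightarrow> real) \<Rightarrow> (real \<Rightarrow> 'a \<Rightarrow> real) \<Rightarrow> real \<Rightarrow> 'a measure" where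
  "augmented_filtration M W B t = sigma (space M)
     ({W s -` A \<inter> space M | s A. s \<in> {0..t} \<and> A \<in> sets borel} \<union>
      {B s -` A \<inter> space M | s A. s \<in> {0..t} \<and> A \<in> sets borel} \<union>
      null_sets M)"

text \<open>
  A (strong) solution of \<open>Y(t) = \<integral>\<^sub>0\<^sup>t g(s, W\<^sub>0\<^sup>s, Y\<^sub>0\<^sup>s) ds + B(t)\<close> on \<open>[0,T]\<close>. Integrability of the
  drift is required because the Lebesgue integral of a non-integrable function is \<open>0\<close> by convention.
\<close>

definition sde_solution ::
  "'a measure \<Rightarrow> real \<Rightarrow> (real \<Rightarrow> (real \<Rightarrow> real) \<Rightarrow> (real \<Rightarrow> real) \<Rightarrow> real) \<Rightarrow>
   (real \<Rightarrow> 'a \<Rightarrow> real) \<Rightarrow> (real \<Rightarrow> 'a \<Rightarrow> real) \<Rightarrow> (real \<Rightarrow> 'a \<Rightarrow> real) \<Rightarrow> bool" where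
  "sde_solution M T g W B Y \<longleftrightarrow>
     continuous_process M T Y \<and>
     (\<forall>t\<in>{0..T}. Y t \<in> borel_measurable (augmented_filtration M W B t)) \<and>
     (AE \<omega> in M.
        set_integrable lborel {0..T}
          (\<lambda>s. g s (stopped_path T s W \<omega>) (stopped_path T s Y \<omega>)) \<and>
        (\<forall>t\<in>{0..T}. Y t \<omega> =
           set_lebesgue_integral lborel {0..t}
             (\<lambda>s. g s (stopped_path T s W \<omega>) (stopped_path T s Y \<omega>)) + B t \<omega>))"

text \<open>\<open>Y\<close> is a solution, and any other solution is indistinguishable from it.\<close>

definition unique_sde_solution ::
  "'a measure \<Rightarrow> real \<Rightarrow> (real \<Rightarrow> (real \<Rightarrow> real) \<Rightarrow> (real \<Rightarrow> real) \<Rightarrow> real) \<Rightarrow>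
   (real \<Rightarrow> 'a \<Rightarrow> real) \<Rightarrow> (real \<Rightarrow> 'a \<Rightarrow> real) \<Rightarrow> (real \<Rightarrow> 'a \<Rightarrow> real) \<Rightarrow> bool" where
  "unique_sde_solution M T g W B Y \<longleftrightarrow>
     sde_solution M T g W B Y \<and>
     (\<forall>Y'. sde_solution M T g W B Y' \<longrightarrow>
        (AE \<omega> in M. \<forall>t\<in>{0..T}. Y' t \<omega> = Y t \<omega>))"

text \<open>
  The expectation as an extended real, \<open>E[X\<^sup>+] - E[X\<^sup>-]\<close>; \<^const>\<open>ennreal\<close> maps negative reals
  to \<open>0\<close>. Below, the negative part always has a finite expectation.
\<close>

definition ext_expectation :: "'a measure \<Rightarrow> ('a \<Rightarrow> real) \<Rightarrow> ereal" where
  "ext_expectation M X =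
     enn2ereal (\<integral>\<^sup>+ \<omega>. ennreal (X \<omega>) \<partial>M) - enn2ereal (\<integral>\<^sup>+ \<omega>. ennreal (- X \<omega>) \<partial>M)"

text \<open>
  Mutual information (in nats) of a random element \<open>U\<close> of \<open>S\<close> and a random element \<open>V\<close> of \<open>R\<close>.
  The library's \<open>mutual_information\<close> is real-valued and hence cannot take the value \<open>\<infinity>\<close>. The
  derivative is positive and finite almost everywhere with respect to the joint law, so the
  values of \<^const>\<open>ln\<close> at \<open>0\<close> and of \<^const>\<open>enn2real\<close> at \<open>\<infinity>\<close> are irrelevant.
\<close>

definition mutual_info ::
  "'a measure \<Rightarrow> 'b measure \<Rightarrow> 'c measure \<Rightarrow> ('a \<Rightarrow> 'b) \<Rightarrow> ('a \<Rightarrow> 'c) \<Rightarrow> ereal" where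
  "mutual_info M S R U V =
     (let P = distr M S U \<Otimes>\<^sub>M distr M R V;
          J = distr M (S \<Otimes>\<^sub>M R) (\<lambda>\<omega>. (U \<omega>, V \<omega>))
      in if \<exists>f. f \<in> borel_measurable P \<and> density P f = J
         then ext_expectation M (\<lambda>\<omega>. ln (enn2real (RN_deriv P J (U \<omega>, V \<omega>))))
         else \<infinity>)"

text \<open>The random vector \<open>(Y(t\<^sub>0), \<dots>, Y(t\<^sub>n))\<close>, with values in \<^term>\<open>Pi\<^sub>M {0..n} (\<lambda>_. borel)\<close>.\<close>

definition sample_vector :: "nat \<Rightarrow> (nat \<Rightarrow> real) \<Rightarrow> (real \<Rightarrow> 'a \<Rightarrow> real) \<Rightarrow> 'a \<Rightarrow> nat \<Rightarrow> real" where
  "sample_vector n t Y \<omega> = (\<lambda>i\<in>{0..n}. Y (t i) \<omega>)"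

definition mesh :: "nat \<Rightarrow> (nat \<Rightarrow> real) \<Rightarrow> real" where
  "mesh n t = Max ((\<lambda>i. t i - t (i - 1)) ` {1..n})"

end

theory Submission
  imports Defs
begin

text \<open>
  Mutual information is continuous along any increasing sequence of observations that together generate the sigma-algebra of the limit.
  Relative entropy is the supremum, over bounded measurable \<open>h\<close>, of \<open>\<integral>h dJ - \<integral>(e\<^sup>h - 1) dP\<close>, and
  this supremum is \<open>\<infinity>\<close> if \<open>J\<close> has no density. For the images of \<open>P\<close> and \<open>J\<close> under
  the observation \<open>X n\<close> the supremum is restricted to functions of \<open>X n\<close>; it increases with \<open>n\<close>, and it
  reaches the full supremum in the limit because functions of the observations are dense in
  \<open>L\<^sup>1(P + J)\<close>. Samples of a continuous path on grids with vanishing mesh determine the path, so they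
  form such a sequence.
\<close>

section \<open>Variational formula for the relative entropy\<close>

text \<open>The Kullback-Leibler divergence of \<open>J\<close> from \<open>P\<close>, with the same
  case distinction and extended expectation as \<open>mutual_info\<close>. It refers only to the two
  measures, so that an observation acts on it simply through \<open>distr\<close>.\<close>

definition relative_entropy :: "'b measure \<Rightarrow> 'b measure \<Rightarrow> ereal" where
  "relative_entropy P J =
     (if \<exists>f. f \<in> borel_measurable P \<and> density P f = J
      then ext_expectation J (\<lambda>x. ln (enn2real (RN_deriv P J x)))
      else \<infinity>)"

lemma mutual_info_eq_relative_entropy:
  assumes [measurable]: "U \<in> measurable M S" "V \<in> measurable M R"
  shows "mutual_info M S R U V =
    relative_entropy (distr M S U \<Otimes>\<^sub>M distr M R V) (distr M (S \<Otimes>\<^sub>M R) (\<lambda>\<omega>. (U \<omega>, V \<omega>)))"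
proof -
  define P where "P = distr M S U \<Otimes>\<^sub>M distr M R V"
  define J where "J = distr M (S \<Otimes>\<^sub>M R) (\<lambda>\<omega>. (U \<omega>, V \<omega>))"
  have sets_P: "sets P = sets (S \<Otimes>\<^sub>M R)"
    unfolding P_def by (simp cong: sets_pair_measure_cong)
  have [measurable]: "RN_deriv P J \<in> borel_measurable (S \<Otimes>\<^sub>M R)"
    using borel_measurable_RN_deriv[of P J] measurable_cong_sets[OF sets_P refl] by blast
  have "ext_expectation J (\<lambda>x. ln (enn2real (RN_deriv P J x))) =
      ext_expectation M (\<lambda>\<omega>. ln (enn2real (RN_deriv P J (U \<omega>, V \<omega>))))"
  proof -
    define L where "L x = ln (enn2real (RN_deriv P J x))" for x
    have [measurable]: "L \<in> borel_measurable (S \<Otimes>\<^sub>M R)" unfolding L_def by measurable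
    show ?thesis
      unfolding ext_expectation_def L_def[symmetric] unfolding J_def by (simp add: nn_integral_distr)
  qed
  then show ?thesis
    unfolding mutual_info_def relative_entropy_def Let_def P_def[symmetric] J_def[symmetric] by auto
qed

text \<open>\<open>e\<^sup>h - 1\<close> is the convex conjugate of \<open>x ln x - x + 1\<close>. Unlike the formula of Donsker and Varadhan,
  this one has no logarithm of an integral, so that it is controlled by \<open>L\<^sup>1\<close> distances of \<open>h\<close>.\<close>

definition entropy_functional :: "'b measure \<Rightarrow> 'b measure \<Rightarrow> ('b \<Rightarrow> real) \<Rightarrow> real" where
  "entropy_functional P J h = (\<integral>x. h x \<partial>J) - (\<integral>x. exp (h x) - 1 \<partial>P)"

section \<open>Scalar inequalities for x ln x - x + 1 and its truncations\<close>

text \<open>Fenchel-Young inequality for this conjugate pair: apply 1 + u \<le> e^u at u = h - ln r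
  and multiply by r. Equality holds at h = ln r, which makes ln r the optimal test function
  later.\<close>

lemma entropy_young:
  fixes r h :: real
  assumes "0 \<le> r"
  shows "r * h \<le> (r * ln r - r + 1) + (exp h - 1)"
proof (cases "r = 0")
  case False
  then have r: "0 < r" using assms by simp
  have "1 + (h - ln r) \<le> exp (h - ln r)" by (rule exp_ge_add_one_self)
  then have "r * (1 + (h - ln r)) \<le> r * exp (h - ln r)" using r by simp
  also have "r * exp (h - ln r) = exp h" using r by (simp add: exp_diff)
  finally show ?thesis by (simp add: algebra_simps)
qed simp

lemma entropy_integrand_nonneg:
  fixes r :: real
  assumes "0 \<le> r"
  shows "0 \<le> r * ln r - r + 1"
  using entropy_young[OF assms, of 0] by simp

text \<open>Truncation to [1/K, K] moves r down only to K \<ge> 1 and up only to 1/K \<le> 1, so (r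
  - c) ln c \<ge> 0. This reduces the claim to c ln c - c + 1 \<ge> 0. The nonnegativity is what
  Fatou's lemma needs below.\<close>

lemma clamped_young_nonneg:
  fixes r K :: real
  assumes r: "0 \<le> r" and K: "1 \<le> K"
  defines "c \<equiv> max (1 / K) (min K r)"
  shows "0 \<le> r * ln c - c + 1"
proof -
  have c: "0 < c" unfolding c_def using K by (intro less_max_iff_disj[THEN iffD2] disjI1) simp
  have "r * ln c \<ge> c * ln c"
  proof (cases "r \<ge> c")
    case True
    have "1 / K \<le> K" using K by (simp add: divide_le_eq) (metis mult_mono' mult_1 zero_le_one)
    then have "1 \<le> c \<or> c = r" using True K r unfolding c_def by (auto simp: max_def min_def split: if_splits)
    then show ?thesis
    proof
      assume "1 \<le> c" then show ?thesis using True by (intro mult_right_mono) auto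
    qed simp
  next
    case False
    then have "c \<le> 1" using K r unfolding c_def by (auto simp: max_def min_def field_simps split: if_splits)
    then have "ln c \<le> 0" using c by simp
    then show ?thesis using False by (intro mult_right_mono_neg) auto
  qed
  then show ?thesis using entropy_integrand_nonneg[of c] c by linarith
qed

text \<open>For r > 0 the truncation is eventually inactive. For r = 0 the logarithmic term has
  coefficient 0, and the truncated value 1/(k+1) tends to 0.\<close>

lemma clamped_young_tendsto:
  fixes r :: real
  assumes r: "0 \<le> r"
  shows "(\<lambda>k. r * ln (max (1 / real (Suc k)) (min (real (Suc k)) r)) - max (1 / real (Suc k)) (min (real (Suc k)) r) + 1)
     \<longlonglongrightarrow> r * ln r - r + 1"
proof (cases "r = 0")
  case True
  have "(\<lambda>k. - (1 / real (Suc k)) + 1) \<longlonglongrightarrow> - 0 + (1::real)"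
    by (intro tendsto_intros LIMSEQ_Suc[OF lim_1_over_n])
  then show ?thesis using True by (simp add: max_def)
next
  case False
  then have "0 < r" using r by simp
  obtain N :: nat where N: "max r (1 / r) \<le> real N" using real_arch_simple by blast
  have "\<forall>\<^sub>F k in sequentially. max (1 / real (Suc k)) (min (real (Suc k)) r) = r"
  proof (rule eventually_sequentiallyI[of N])
    fix k assume "N \<le> k"
    then have "r \<le> real (Suc k)" "1 / r \<le> real (Suc k)" using N by auto
    then show "max (1 / real (Suc k)) (min (real (Suc k)) r) = r"
      using \<open>0 < r\<close> by (auto simp: max_def min_def field_simps)
  qed
  then show ?thesis
    by (intro tendsto_eventually) (auto elim: eventually_mono)
qed

text \<open>Adding \<open>1 - r\<close>, whose integral is zero, makes the integrand nonnegative.\<close>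

lemma relative_entropy_eq_nn_integral:
  assumes "prob_space P" "prob_space J" "f \<in> borel_measurable P" "density P f = J"
  obtains r where "r \<in> borel_measurable P" "\<And>x. 0 \<le> r x" "density P (\<lambda>x. ennreal (r x)) = J"
    "relative_entropy P J = enn2ereal (\<integral>\<^sup>+ x. ennreal (r x * ln (r x) - r x + 1) \<partial>P)"
proof -
  interpret P: prob_space P by fact
  interpret J: prob_space J by fact
  define r where "r x = enn2real (RN_deriv P J x)" for x
  have r_meas[measurable]: "r \<in> borel_measurable P"
    unfolding r_def by measurable
  have r_nonneg: "0 \<le> r x" for x by (simp add: r_def)
  have RN: "density P (RN_deriv P J) = J"
    using assms(3,4) by (rule RN_derivI)
  \<comment> \<open>The derivative has total mass 1, hence is finite \<open>P\<close>-almost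
    everywhere, and its real version \<open>r\<close> is still a density of
    \<open>J\<close>.\<close>
  have "(\<integral>\<^sup>+ x. RN_deriv P J x \<partial>P) = emeasure (density P (RN_deriv P J)) (space P)"
    by (simp add: emeasure_density cong: nn_integral_cong)
  also have "\<dots> = 1"
    using J.emeasure_space_1 unfolding RN by (metis RN space_density)
  finally have "AE x in P. RN_deriv P J x \<noteq> \<infinity>"
    by (intro nn_integral_PInf_AE) auto
  then have AE_r: "AE x in P. RN_deriv P J x = ennreal (r x)"
    by eventually_elim (simp add: r_def top.not_eq_extremum)
  have dens: "density P (\<lambda>x. ennreal (r x)) = J"
    by (subst RN[symmetric], rule density_cong) (use AE_r in auto)
  have total: "(\<integral>\<^sup>+ x. ennreal (r x) \<partial>P) = 1"
    using J.emeasure_space_1 unfolding dens[symmetric] by (simp add: emeasure_density cong: nn_integral_cong)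
  define p where "p = (\<integral>\<^sup>+ x. ennreal (r x * max 0 (ln (r x))) \<partial>P)"
  define q where "q = (\<integral>\<^sup>+ x. ennreal (r x * max 0 (- ln (r x))) \<partial>P)"
  define k where "k = (\<integral>\<^sup>+ x. ennreal (r x * ln (r x) - r x + 1) \<partial>P)"
  have p: "(\<integral>\<^sup>+ x. ennreal (ln (r x)) \<partial>J) = p"
    unfolding p_def dens[symmetric]
    by (subst nn_integral_density)
       (auto simp: r_nonneg ennreal_mult' ennreal_max_0 intro!: nn_integral_cong)
  have q: "(\<integral>\<^sup>+ x. ennreal (- ln (r x)) \<partial>J) = q"
    unfolding q_def dens[symmetric]
    by (subst nn_integral_density)
       (auto simp: r_nonneg ennreal_mult' ennreal_max_0 intro!: nn_integral_cong)
  \<comment> \<open>From r ln r - r + 1 \<ge> 0 follows - r ln r \<le> 1. So the negative part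
    \<open>q\<close> is finite, and the extended expectation \<open>p\<close> - \<open>q\<close> is
    never of the form \<infinity> - \<infinity>.\<close>
  have neg_bound: "r x * max 0 (- ln (r x)) \<le> 1" for x
    using entropy_integrand_nonneg[OF r_nonneg[of x]] r_nonneg[of x] by (auto simp: max_def)
  have "q \<le> (\<integral>\<^sup>+ x. 1 \<partial>P)"
    unfolding q_def by (intro nn_integral_mono) (use neg_bound in auto)
  then have q_fin: "q \<noteq> \<infinity>" using P.emeasure_space_1 by (auto simp: top_unique)
  \<comment> \<open>The relation k = p - q is proved in additive form, since \<open>k\<close> and
    \<open>p\<close> may be infinite. The 1 on the left is the integral of \<open>r\<close>, the one
    on the right is the mass of \<open>P\<close>.\<close>
  have "k + q + 1 = (\<integral>\<^sup>+ x. ennreal (r x * ln (r x) - r x + 1) + ennreal (r x * max 0 (- ln (r x))) + ennreal (r x) \<partial>P)"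
    unfolding k_def q_def total[symmetric] by (simp add: nn_integral_add)
  also have "\<dots> = (\<integral>\<^sup>+ x. ennreal (r x * max 0 (ln (r x))) + 1 \<partial>P)"
  proof (intro nn_integral_cong)
    fix x
    show "ennreal (r x * ln (r x) - r x + 1) + ennreal (r x * max 0 (- ln (r x))) + ennreal (r x)
        = ennreal (r x * max 0 (ln (r x))) + 1"
      using entropy_integrand_nonneg[OF r_nonneg[of x]] r_nonneg[of x]
      by (auto simp: max_def ennreal_plus[symmetric] ennreal_1[symmetric] simp del: ennreal_plus ennreal_1 intro!: arg_cong[of _ _ ennreal])
  qed
  also have "\<dots> = p + 1"
    unfolding p_def using P.emeasure_space_1 by (simp add: nn_integral_add)
  finally have "k + q = p" by simp
  then have "enn2ereal p = enn2ereal k + enn2ereal q" by (simp flip: plus_ennreal.rep_eq)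
  then have "enn2ereal p - enn2ereal q = enn2ereal k"
    using q_fin by (cases q; cases "enn2ereal k") (auto simp: enn2ereal_ennreal)
  then have "relative_entropy P J = enn2ereal k"
    unfolding relative_entropy_def ext_expectation_def r_def[symmetric] p q using assms(3,4) by auto
  with r_meas r_nonneg dens show ?thesis by (intro that) (auto simp: k_def)
qed

lemma ennreal_integral_le_nn_integral:
  fixes f :: "'b \<Rightarrow> real"
  assumes f: "integrable M f"
  shows "ennreal (\<integral>x. f x \<partial>M) \<le> (\<integral>\<^sup>+ x. ennreal (f x) \<partial>M)"
proof -
  have "ennreal (\<integral>x. f x \<partial>M) \<le> ennreal (\<integral>x. max 0 (f x) \<partial>M)"
    using f by (intro ennreal_leI integral_mono) auto
  also have "\<dots> = (\<integral>\<^sup>+ x. ennreal (max 0 (f x)) \<partial>M)"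
    using f by (intro nn_integral_eq_integral[symmetric]) auto
  also have "\<dots> = (\<integral>\<^sup>+ x. ennreal (f x) \<partial>M)" by simp
  finally show ?thesis .
qed

text \<open>With a density r, the upper bound is Young's inequality integrated against
  \<open>P\<close>, and the logarithms of the truncations of r approach it by Fatou's lemma. Without
  a density, some \<open>P\<close>-null set has positive \<open>J\<close>-measure, and multiples of
  its indicator make the functional arbitrarily large.\<close>

lemma relative_entropy_eq_SUP:
  assumes P: "prob_space P" and J: "prob_space J" and sets_J: "sets J = sets P"
  shows "relative_entropy P J =
    (SUP h\<in>{h \<in> borel_measurable P. bounded (range h)}. ereal (entropy_functional P J h))"
    (is "_ = Sup (?F ` ?H)")
proof -
  interpret P: prob_space P by fact
  interpret J: prob_space J by fact
  have meas_J: "measurable J borel = measurable P (borel :: real measure)"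
    by (rule measurable_cong_sets[OF sets_J refl])
  have int: "integrable P h" "integrable J h" "integrable P (\<lambda>x. exp (h x))"
    if "h \<in> ?H" for h :: "'a \<Rightarrow> real"
  proof -
    from that obtain C where C: "\<And>x. \<bar>h x\<bar> \<le> C" and [measurable]: "h \<in> borel_measurable P"
      by (auto simp: bounded_iff)
    show "integrable P h" by (rule P.integrable_const_bound[of _ C]) (use C in auto)
    show "integrable J h" by (rule J.integrable_const_bound[of _ C]) (use C in \<open>auto simp: meas_J\<close>)
    show "integrable P (\<lambda>x. exp (h x))"
      by (rule P.integrable_const_bound[of _ "exp C"]) (use C abs_le_D1 in \<open>auto\<close>)
  qed
  show ?thesis
  proof (cases "\<exists>f. f \<in> borel_measurable P \<and> density P f = J")
    case False
    then have "\<not> absolutely_continuous P J"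
      using P.Radon_Nikodym[of J] sets_J by metis
    then obtain A where A: "A \<in> null_sets P" "A \<notin> null_sets J"
      unfolding absolutely_continuous_def by auto
    then have sA[measurable]: "A \<in> sets P" and sJ[measurable]: "A \<in> sets J" using sets_J by auto
    have pos: "0 < measure J A"
      using A(2) sJ by (auto simp: null_sets_def J.emeasure_eq_measure less_le)
    \<comment> \<open>The exponential term vanishes \<open>P\<close>-almost everywhere because
      \<open>A\<close> is a null set, so the functional is linear in \<open>c\<close>.\<close>
    have val: "entropy_functional P J (\<lambda>x. c * indicator A x) = c * measure J A" for c
    proof -
      have "AE x in P. exp (c * indicator A x) - 1 = 0"
        using AE_not_in[OF A(1)] by eventually_elim simp
      then have "(\<integral>x. exp (c * indicator A x) - 1 \<partial>P) = (\<integral>x. 0 \<partial>P)"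
        by (intro integral_cong_AE) simp_all
      then show ?thesis unfolding entropy_functional_def
        by (simp add: Int_absorb2[OF sets.sets_into_space[OF sJ]])
    qed
    have "ereal b \<le> Sup (?F ` ?H)" for b
    proof -
      \<comment> \<open>The factor is chosen so that the functional takes exactly the value
        \<open>b\<close>.\<close>
      have mem: "(\<lambda>x. (b / measure J A) * indicator A x) \<in> ?H"
        by (auto simp: bounded_iff indicator_def intro!: exI[of _ "\<bar>b / measure J A\<bar>"])
      show ?thesis
        using SUP_upper[OF mem, of ?F] pos unfolding val by simp
    qed
    then have "Sup (?F ` ?H) = \<infinity>" by (rule ereal_top)
    then show ?thesis using False by (auto simp: relative_entropy_def)
  next
    case True
    then obtain f where f: "f \<in> borel_measurable P" "density P f = J" by blast
    obtain r where [measurable]: "r \<in> borel_measurable P" and r: "\<And>x. 0 \<le> r x"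
      and dens: "density P (\<lambda>x. ennreal (r x)) = J"
      and eq: "relative_entropy P J = enn2ereal (\<integral>\<^sup>+ x. ennreal (r x * ln (r x) - r x + 1) \<partial>P)"
      by (rule relative_entropy_eq_nn_integral[OF P J f]) (rule that)
    have int_r: "integrable P (\<lambda>x. r x * h x)" and integral_r: "(\<integral>x. h x \<partial>J) = (\<integral>x. r x * h x \<partial>P)"
      if h: "h \<in> ?H" for h :: "'a \<Rightarrow> real"
    proof -
      have [measurable]: "h \<in> borel_measurable P" using h by simp
      have "integrable (density P (\<lambda>x. ennreal (r x))) h" using int(2)[OF h] unfolding dens .
      then show "integrable P (\<lambda>x. r x * h x)"
        by (subst (asm) integrable_density) (auto simp: r)
      show "(\<integral>x. h x \<partial>J) = (\<integral>x. r x * h x \<partial>P)"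
        unfolding dens[symmetric] by (subst integral_density) (auto simp: r)
    qed
    \<comment> \<open>Everything is gathered into one integral against \<open>P\<close>; the
      constant + 1 comes from the total mass of \<open>P\<close>. The integrand can then be compared
      pointwise with r ln r - r + 1.\<close>
    have val: "entropy_functional P J h = (\<integral>x. r x * h x - exp (h x) + 1 \<partial>P)" if h: "h \<in> ?H" for h
      unfolding entropy_functional_def integral_r[OF h]
      using int_r[OF h] int(3)[OF h] P.prob_space by simp
    show ?thesis
    proof (rule antisym)
      \<comment> \<open>The optimal choice ln r need not be bounded, so r is first truncated to
        [1/(k+1), k+1].\<close>
      define c where "c k x = max (1 / real (Suc k)) (min (real (Suc k)) (r x))" for k x
      define h where "h k x = ln (c k x)" for k x
      have c: "1 / real (Suc k) \<le> c k x" "c k x \<le> real (Suc k)" for k x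
        by (auto simp: c_def field_simps)
      have c_pos: "0 < c k x" for k x by (rule less_le_trans[OF _ c(1)]) simp
      have [measurable]: "c k \<in> borel_measurable P" for k unfolding c_def by measurable
      have hH: "h k \<in> ?H" for k
      proof -
        have "\<bar>h k x\<bar> \<le> ln (real (Suc k))" for x
        proof -
          have "h k x \<le> ln (real (Suc k))" unfolding h_def using c c_pos by simp
          moreover have "ln (1 / real (Suc k)) \<le> h k x" unfolding h_def using c c_pos
            by (subst ln_le_cancel_iff) auto
          ultimately show ?thesis by (simp add: ln_div)
        qed
        moreover have "h k \<in> borel_measurable P" unfolding h_def by measurable
        ultimately show ?thesis by (auto simp: bounded_iff)
      qed
      have exp_h: "exp (h k x) = c k x" for k x unfolding h_def using c_pos by simp
      have nonneg: "0 \<le> r x * h k x - exp (h k x) + 1" for k x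
        unfolding exp_h unfolding h_def c_def by (rule clamped_young_nonneg) (use r in auto)
      have lim: "(\<lambda>k. ennreal (r x * h k x - exp (h k x) + 1)) \<longlonglongrightarrow> ennreal (r x * ln (r x) - r x + 1)" for x
        unfolding exp_h unfolding h_def c_def by (intro tendsto_ennrealI clamped_young_tendsto r)
      have meas: "(\<lambda>x. ennreal (r x * h k x - exp (h k x) + 1)) \<in> borel_measurable P" for k
      proof -
        have [measurable]: "h k \<in> borel_measurable P" using hH[of k] by simp
        show ?thesis by measurable
      qed
      \<comment> \<open>Fatou's lemma: the integrands for \<open>h k\<close> are nonnegative and
        converge pointwise. It applies whether or not the limit has a finite integral.\<close>
      have "(\<integral>\<^sup>+ x. ennreal (r x * ln (r x) - r x + 1) \<partial>P) =
          (\<integral>\<^sup>+ x. liminf (\<lambda>k. ennreal (r x * h k x - exp (h k x) + 1)) \<partial>P)"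
        using lim by (intro nn_integral_cong) (metis lim_imp_Liminf trivial_limit_sequentially)
      also have "\<dots> \<le> liminf (\<lambda>k. \<integral>\<^sup>+ x. ennreal (r x * h k x - exp (h k x) + 1) \<partial>P)"
        by (rule nn_integral_liminf[OF meas])
      also have "\<dots> \<le> e2ennreal (Sup (?F ` ?H))"
      proof (rule Liminf_le[OF _ always_eventually, THEN order_trans]; (rule allI)?)
        fix k
        have "(\<integral>\<^sup>+ x. ennreal (r x * h k x - exp (h k x) + 1) \<partial>P) = ennreal (entropy_functional P J (h k))"
          unfolding val[OF hH]
          by (rule nn_integral_eq_integral) (use int_r[OF hH] int(3)[OF hH] nonneg in auto)
        also have "\<dots> = e2ennreal (?F (h k))" by (simp add: ennreal.rep_eq[symmetric] e2ennreal_def ennreal_def)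
        also have "\<dots> \<le> e2ennreal (Sup (?F ` ?H))"
          by (intro e2ennreal_mono SUP_upper hH)
        finally show "(\<integral>\<^sup>+ x. ennreal (r x * h k x - exp (h k x) + 1) \<partial>P) \<le> e2ennreal (Sup (?F ` ?H))" .
      qed auto
      finally have "relative_entropy P J \<le> enn2ereal (e2ennreal (Sup (?F ` ?H)))"
        unfolding eq by (simp add: less_eq_ennreal.rep_eq)
      \<comment> \<open>\<open>e2ennreal\<close> sends negative values to 0. The test function 0
        shows that the supremum is nonnegative, so the conversion can be undone.\<close>
      moreover have "0 \<le> Sup (?F ` ?H)"
        by (rule SUP_upper2[of "\<lambda>_. 0"]) (auto simp: entropy_functional_def zero_ereal_def)
      ultimately show "relative_entropy P J \<le> Sup (?F ` ?H)" by (simp add: enn2ereal_e2ennreal)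
    next
      show "Sup (?F ` ?H) \<le> relative_entropy P J"
      proof (rule SUP_least)
        fix h assume h: "h \<in> ?H"
        have "ennreal (entropy_functional P J h) \<le> (\<integral>\<^sup>+ x. ennreal (r x * h x - exp (h x) + 1) \<partial>P)"
          unfolding val[OF h]
          by (rule ennreal_integral_le_nn_integral) (use int_r[OF h] int(3)[OF h] in auto)
        also have "\<dots> \<le> (\<integral>\<^sup>+ x. ennreal (r x * ln (r x) - r x + 1) \<partial>P)"
          by (intro nn_integral_mono ennreal_leI) (use entropy_young[OF r] in \<open>auto simp: algebra_simps\<close>)
        finally have "enn2ereal (ennreal (entropy_functional P J h)) \<le> relative_entropy P J"
          unfolding eq by (simp add: less_eq_ennreal.rep_eq)
        moreover have "ereal a \<le> enn2ereal (ennreal a)" for a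
          by (cases "0 \<le> a") (auto simp: enn2ereal_ennreal ennreal_neg zero_ennreal.rep_eq)
        ultimately show "?F h \<le> relative_entropy P J" using order_trans by blast
      qed
    qed
  qed
qed

section \<open>Approximation by functions of an observation\<close>

text \<open>Refinement is expressed by explicit maps between the observation spaces instead of
  inclusions of sigma-algebras, so a function of \<open>X n\<close> becomes a function of a later
  \<open>X m\<close> by mere composition.\<close>

locale refining_maps = finite_measure M for M :: "'b measure" +
  fixes N :: "nat \<Rightarrow> 'c measure" and X :: "nat \<Rightarrow> 'b \<Rightarrow> 'c"
  assumes X_measurable[measurable]: "\<And>n. X n \<in> measurable M (N n)"
    and refine: "\<And>n m. n \<le> m \<Longrightarrow> \<exists>\<phi>\<in>measurable (N m) (N n). \<forall>x\<in>space M. X n x = \<phi> (X m x)"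
    and generate: "sets M \<subseteq> sigma_sets (space M) (\<Union>n. (\<lambda>A. X n -` A \<inter> space M) ` sets (N n))"
begin

text \<open>Intended as the \<open>L\<^sup>1\<close> closure of the functions of a single
  observation. A Bochner integral of a non-integrable difference would be 0 by default, so the
  closure under sums and limits is stated for integrable functions.\<close>

definition approximable :: "('b \<Rightarrow> real) \<Rightarrow> bool" where
  "approximable f \<longleftrightarrow> (\<forall>e>0. \<exists>n. \<exists>h\<in>borel_measurable (N n).
     integrable M (\<lambda>x. h (X n x)) \<and> (\<integral>x. \<bar>f x - h (X n x)\<bar> \<partial>M) < e)"

lemma approximable_comp:
  assumes "h \<in> borel_measurable (N n)" "integrable M (\<lambda>x. h (X n x))"
    "\<And>x. x \<in> space M \<Longrightarrow> f x = h (X n x)"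
  shows "approximable f"
proof -
  have "(\<integral>x. \<bar>f x - h (X n x)\<bar> \<partial>M) = 0"
    using assms(3) by (intro integral_eq_zero_AE) auto
  then show ?thesis unfolding approximable_def using assms(1,2) by (metis (no_types))
qed

lemma approximable_cmult:
  assumes "approximable f"
  shows "approximable (\<lambda>x. c * f x)"
  unfolding approximable_def
proof (intro allI impI)
  fix e :: real assume "0 < e"
  \<comment> \<open>Adding 1 covers the case c = 0.\<close>
  then have "0 < e / (\<bar>c\<bar> + 1)" by simp
  then obtain n h where h[measurable]: "h \<in> borel_measurable (N n)"
    and int: "integrable M (\<lambda>x. h (X n x))"
    and less: "(\<integral>x. \<bar>f x - h (X n x)\<bar> \<partial>M) < e / (\<bar>c\<bar> + 1)"
    using assms[unfolded approximable_def, rule_format] by blast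
  have "(\<integral>x. \<bar>c * f x - c * h (X n x)\<bar> \<partial>M) = \<bar>c\<bar> * (\<integral>x. \<bar>f x - h (X n x)\<bar> \<partial>M)"
    by (simp add: abs_mult flip: right_diff_distrib)
  also have "\<dots> \<le> (\<bar>c\<bar> + 1) * (\<integral>x. \<bar>f x - h (X n x)\<bar> \<partial>M)"
    by (intro mult_right_mono) auto
  also have "\<dots> < e" using less by (simp add: field_simps add_pos_nonneg)
  finally show "\<exists>n. \<exists>h\<in>borel_measurable (N n). integrable M (\<lambda>x. h (X n x)) \<and>
      (\<integral>x. \<bar>c * f x - h (X n x)\<bar> \<partial>M) < e"
    using int by (intro exI[of _ n] bexI[of _ "\<lambda>y. c * h y"]) auto
qed

text \<open>The two approximants may belong to different observations; refinement rewrites both as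
  functions of \<open>X (max n m)\<close>, where they can be added.\<close>

lemma approximable_add:
  assumes f: "integrable M f" "approximable f" and g: "integrable M g" "approximable g"
  shows "approximable (\<lambda>x. f x + g x)"
  unfolding approximable_def
proof (intro allI impI)
  fix e :: real assume e: "0 < e"
  obtain n h where h[measurable]: "h \<in> borel_measurable (N n)"
    and int_h: "integrable M (\<lambda>x. h (X n x))"
    and less_h: "(\<integral>x. \<bar>f x - h (X n x)\<bar> \<partial>M) < e / 2"
    using f(2)[unfolded approximable_def, rule_format, of "e / 2"] e by auto
  obtain m k where k[measurable]: "k \<in> borel_measurable (N m)"
    and int_k: "integrable M (\<lambda>x. k (X m x))"
    and less_k: "(\<integral>x. \<bar>g x - k (X m x)\<bar> \<partial>M) < e / 2"
    using g(2)[unfolded approximable_def, rule_format, of "e / 2"] e by auto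
  obtain \<phi> where \<phi>[measurable]: "\<phi> \<in> measurable (N (max n m)) (N n)"
    and \<phi>_eq: "\<And>x. x \<in> space M \<Longrightarrow> X n x = \<phi> (X (max n m) x)"
    using refine[OF max.cobounded1[of n m]] by blast
  obtain \<psi> where \<psi>[measurable]: "\<psi> \<in> measurable (N (max n m)) (N m)"
    and \<psi>_eq: "\<And>x. x \<in> space M \<Longrightarrow> X m x = \<psi> (X (max n m) x)"
    using refine[OF max.cobounded2[of m n]] by blast
  define l where "l y = h (\<phi> y) + k (\<psi> y)" for y
  have l: "l \<in> borel_measurable (N (max n m))" unfolding l_def by measurable
  have l_eq: "l (X (max n m) x) = h (X n x) + k (X m x)" if "x \<in> space M" for x
    unfolding l_def using that \<phi>_eq \<psi>_eq by simp
  have "integrable M (\<lambda>x. l (X (max n m) x)) \<longleftrightarrow> integrable M (\<lambda>x. h (X n x) + k (X m x))"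
    by (intro Bochner_Integration.integrable_cong refl) (auto simp: l_eq)
  then have int_l: "integrable M (\<lambda>x. l (X (max n m) x))" using int_h int_k by simp
  have "(\<integral>x. \<bar>f x + g x - l (X (max n m) x)\<bar> \<partial>M) \<le> (\<integral>x. \<bar>f x - h (X n x)\<bar> + \<bar>g x - k (X m x)\<bar> \<partial>M)"
    using f(1) g(1) int_h int_k int_l by (intro integral_mono) (auto simp: l_eq)
  also have "\<dots> < e"
    using f(1) g(1) int_h int_k less_h less_k by simp
  finally show "\<exists>n. \<exists>h\<in>borel_measurable (N n). integrable M (\<lambda>x. h (X n x)) \<and>
      (\<integral>x. \<bar>f x + g x - h (X n x)\<bar> \<partial>M) < e"
    using l int_l by blast
qed

lemma approximable_limit:
  assumes f: "integrable M f" and s: "\<And>i. integrable M (s i)" "\<And>i. approximable (s i)"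
    and lim: "(\<lambda>i. \<integral>x. \<bar>f x - s i x\<bar> \<partial>M) \<longlonglongrightarrow> 0"
  shows "approximable f"
  unfolding approximable_def
proof (intro allI impI)
  fix e :: real assume e: "0 < e"
  have "\<forall>\<^sub>F i in sequentially. (\<integral>x. \<bar>f x - s i x\<bar> \<partial>M) < e / 2"
    by (rule order_tendstoD(2)[OF lim]) (use e in simp)
  then obtain i where i: "(\<integral>x. \<bar>f x - s i x\<bar> \<partial>M) < e / 2"
    by (auto simp: eventually_sequentially)
  obtain n h where h: "h \<in> borel_measurable (N n)"
    and int: "integrable M (\<lambda>x. h (X n x))"
    and less: "(\<integral>x. \<bar>s i x - h (X n x)\<bar> \<partial>M) < e / 2"
    using s(2)[of i, unfolded approximable_def, rule_format, of "e / 2"] e by auto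
  have "(\<integral>x. \<bar>f x - h (X n x)\<bar> \<partial>M) \<le> (\<integral>x. \<bar>f x - s i x\<bar> + \<bar>s i x - h (X n x)\<bar> \<partial>M)"
    using f s(1) int by (intro integral_mono) auto
  also have "\<dots> < e" using f s(1) int i less by simp
  finally show "\<exists>n. \<exists>h\<in>borel_measurable (N n). integrable M (\<lambda>x. h (X n x)) \<and>
      (\<integral>x. \<bar>f x - h (X n x)\<bar> \<partial>M) < e"
    using h int by blast
qed

lemma approximable_dominated_limit:
  assumes f: "integrable M f" and s: "\<And>i. integrable M (s i)" "\<And>i. approximable (s i)"
    and lim: "\<And>x. x \<in> space M \<Longrightarrow> (\<lambda>i. s i x) \<longlonglongrightarrow> f x"
    and w: "integrable M w" "\<And>i x. x \<in> space M \<Longrightarrow> \<bar>s i x\<bar> \<le> w x"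
  shows "approximable f"
proof (rule approximable_limit[OF f s])
  have "(\<lambda>i. \<integral>x. \<bar>f x - s i x\<bar> \<partial>M) \<longlonglongrightarrow> (\<integral>x. 0 \<partial>M)"
  proof (rule integral_dominated_convergence[where w = "\<lambda>x. \<bar>f x\<bar> + w x"])
    show "AE x in M. (\<lambda>i. \<bar>f x - s i x\<bar>) \<longlonglongrightarrow> 0"
    proof (intro AE_I2)
      fix x assume "x \<in> space M"
      then have "(\<lambda>i. \<bar>f x - s i x\<bar>) \<longlonglongrightarrow> \<bar>f x - f x\<bar>" by (intro tendsto_intros lim)
      then show "(\<lambda>i. \<bar>f x - s i x\<bar>) \<longlonglongrightarrow> 0" by simp
    qed
    show "AE x in M. norm \<bar>f x - s i x\<bar> \<le> \<bar>f x\<bar> + w x" for i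
      using w(2)[of _ i] by (intro AE_I2) (smt (verit) real_norm_def)
  qed (use f s(1) w(1) in auto)
  then show "(\<lambda>i. \<integral>x. \<bar>f x - s i x\<bar> \<partial>M) \<longlonglongrightarrow> 0" by simp
qed

text \<open>Dynkin's argument. The events observed by some \<open>X n\<close> are closed under
  intersection, since two of them are preimages under a common finer observation. Linearity handles
  complements, and dominated convergence handles countable disjoint unions.\<close>

lemma approximable_indicator:
  assumes "A \<in> sets M"
  shows "approximable (indicator A)"
proof -
  let ?G = "\<Union>n. (\<lambda>A. X n -` A \<inter> space M) ` sets (N n)"
  have G_sets: "?G \<subseteq> sets M" by (auto intro: measurable_sets[OF X_measurable])
  have sigma: "sigma_sets (space M) ?G \<subseteq> sets M" by (rule sets.sigma_sets_subset[OF G_sets])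
  have int: "integrable M (indicator A :: 'b \<Rightarrow> real)" if "A \<in> sets M" for A
    using that by (simp add: integrable_indicator_iff emeasure_eq_measure)
  have "Int_stable ?G"
  proof (rule Int_stableI)
    fix a b assume "a \<in> ?G" "b \<in> ?G"
    then obtain n m A B where A: "A \<in> sets (N n)" "a = X n -` A \<inter> space M"
      and B: "B \<in> sets (N m)" "b = X m -` B \<inter> space M" by auto
    obtain \<phi> where \<phi>: "\<phi> \<in> measurable (N (max n m)) (N n)"
      and \<phi>_eq: "\<And>x. x \<in> space M \<Longrightarrow> X n x = \<phi> (X (max n m) x)"
      using refine[OF max.cobounded1[of n m]] by blast
    obtain \<psi> where \<psi>: "\<psi> \<in> measurable (N (max n m)) (N m)"
      and \<psi>_eq: "\<And>x. x \<in> space M \<Longrightarrow> X m x = \<psi> (X (max n m) x)"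
      using refine[OF max.cobounded2[of m n]] by blast
    let ?C = "(\<phi> -` A \<inter> space (N (max n m))) \<inter> (\<psi> -` B \<inter> space (N (max n m)))"
    have "?C \<in> sets (N (max n m))"
      using \<phi> \<psi> A B by (intro sets.Int measurable_sets)
    moreover have "a \<inter> b = X (max n m) -` ?C \<inter> space M"
      using A B \<phi>_eq \<psi>_eq measurable_space[OF X_measurable] by auto
    ultimately show "a \<inter> b \<in> ?G" by blast
  qed
  moreover have "?G \<subseteq> Pow (space M)" by auto
  moreover have "A \<in> sigma_sets (space M) ?G" using assms generate by auto
  ultimately show ?thesis
  proof (induction rule: sigma_sets_induct_disjoint)
    case (basic A)
    then obtain n A' where A': "A' \<in> sets (N n)" "A = X n -` A' \<inter> space M" by auto
    show ?case
      by (rule approximable_comp[of "indicator A'" n])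
        (use A' int measurable_sets[OF X_measurable] in \<open>auto simp: indicator_def intro!: integrable_const_bound[of _ 1]\<close>)
  next
    case empty
    show ?case
      by (rule approximable_comp[of "\<lambda>_. 0" 0]) auto
  next
    case (compl A)
    then have A: "A \<in> sets M" using sigma by auto
    have one: "approximable (\<lambda>x. 1)"
      by (rule approximable_comp[of "\<lambda>_. 1" 0]) auto
    have "approximable (\<lambda>x. 1 + (- 1) * indicator A x)"
      using int[OF A] compl.IH by (intro approximable_add approximable_cmult one) auto
    \<comment> \<open>The two functions differ off \<open>space M\<close>, so they are not equal;
      the integrals in \<open>approximable\<close> see only \<open>space M\<close>.\<close>
    moreover have "approximable (indicator (space M - A)) = approximable (\<lambda>x. 1 + (- 1) * indicator A x)"
      unfolding approximable_def
      by (intro all_cong1 imp_cong refl ex_cong1 bex_cong conj_cong arg_cong[where f="\<lambda>x. x < _"] Bochner_Integration.integral_cong)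
         (auto simp: indicator_def)
    ultimately show ?case by simp
  next
    case (union A)
    then have A: "A i \<in> sets M" for i using sigma by auto
    define s where "s i x = (\<Sum>j<i. indicator (A j) x :: real)" for i x
    have s_int: "integrable M (s i)" for i unfolding s_def using A int by auto
    have s_approx: "approximable (s i)" for i
    proof (induction i)
      case 0
      show ?case unfolding s_def by (rule approximable_comp[of "\<lambda>_. 0" 0]) auto
    next
      case (Suc i)
      have "s (Suc i) = (\<lambda>x. s i x + indicator (A i) x)" unfolding s_def by auto
      then show ?case
        using approximable_add[OF s_int Suc int[OF A] union.IH] by simp
    qed
    \<comment> \<open>By disjointness each partial sum is itself an indicator, hence bounded by
      1.\<close>
    have s_eq: "s i x = indicator (\<Union>j<i. A j) x" for i x
      unfolding s_def using union.hyps
      by (intro indicator_UN_disjoint[symmetric]) (auto simp: disjoint_family_on_def)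
    show ?case
    proof (rule approximable_dominated_limit[of _ s "\<lambda>_. 1"])
      show "integrable M (indicator (\<Union>i. A i) :: 'b \<Rightarrow> real)" using A by (intro int) auto
      show "(\<lambda>i. s i x) \<longlonglongrightarrow> indicator (\<Union>i. A i) x" for x
        unfolding s_eq by (rule LIMSEQ_indicator_UN)
      show "\<bar>s i x\<bar> \<le> 1" for i x unfolding s_eq by (simp add: indicator_def)
    qed (use s_int s_approx in auto)
  qed
qed

lemma approximable_integrable:
  assumes "integrable M f"
  shows "approximable f"
  using assms
proof (induction rule: integrable_induct)
  case (base A c)
  then show ?case
    using approximable_cmult[OF approximable_indicator, of A c] by (simp add: mult.commute)
next
  case (add f g)
  then show ?case by (intro approximable_add)
next
  case (lim f s)
  show ?case
    \<comment> \<open>The bound 2|f| is part of the limit case of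
      \<open>integrable_induct\<close>.\<close>
    by (rule approximable_dominated_limit[of _ s "\<lambda>x. 2 * \<bar>f x\<bar>"]) (use lim in auto)
qed

text \<open>Clamping the approximant to [-C, C] cannot increase its distance to f, whose values lie
  there. The bound on the approximant makes exp Lipschitz on the relevant range, and the nonnegative
  integral passes to any smaller measure.\<close>

lemma bounded_approximation:
  assumes f: "f \<in> borel_measurable M" "\<And>x. \<bar>f x\<bar> \<le> C" and e: "0 < e"
  obtains n h where "h \<in> borel_measurable (N n)" "\<And>y. \<bar>h y\<bar> \<le> C"
    "(\<integral>\<^sup>+ x. ennreal \<bar>f x - h (X n x)\<bar> \<partial>M) < ennreal e"
proof -
  have int_f: "integrable M f" by (rule integrable_const_bound[of _ C]) (use f in auto)
  obtain n h where h[measurable]: "h \<in> borel_measurable (N n)"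
    and int: "integrable M (\<lambda>x. h (X n x))"
    and less: "(\<integral>x. \<bar>f x - h (X n x)\<bar> \<partial>M) < e"
    using approximable_integrable[OF int_f] e unfolding approximable_def by blast
  have C: "0 \<le> C" using f(2)[of undefined] by linarith
  define k where "k y = max (- C) (min C (h y))" for y
  have "\<bar>f x - k (X n x)\<bar> \<le> \<bar>f x - h (X n x)\<bar>" for x
    using f(2)[of x] by (auto simp: k_def max_def min_def)
  then have "(\<integral>\<^sup>+ x. ennreal \<bar>f x - k (X n x)\<bar> \<partial>M) \<le> (\<integral>\<^sup>+ x. ennreal \<bar>f x - h (X n x)\<bar> \<partial>M)"
    by (intro nn_integral_mono ennreal_leI)
  also have "\<dots> = ennreal (\<integral>x. \<bar>f x - h (X n x)\<bar> \<partial>M)"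
    using int_f int by (intro nn_integral_eq_integral) auto
  also have "\<dots> < ennreal e" using less e by (simp add: ennreal_less_iff)
  finally have "(\<integral>\<^sup>+ x. ennreal \<bar>f x - k (X n x)\<bar> \<partial>M) < ennreal e" .
  moreover have "k \<in> borel_measurable (N n)" unfolding k_def by measurable
  moreover have "\<bar>k y\<bar> \<le> C" for y using C by (auto simp: k_def)
  ultimately show ?thesis by (rule that[rotated 2])
qed

end

section \<open>Convergence of the relative entropy\<close>

text \<open>The tangent of exp at x gives e^x - e^y \<le> e^x (x - y); the other sign follows by
  exchanging the two points.\<close>

lemma exp_Lipschitz_on_bounded:
  fixes a b :: real
  assumes "\<bar>a\<bar> \<le> C" "\<bar>b\<bar> \<le> C"
  shows "\<bar>exp a - exp b\<bar> \<le> exp C * \<bar>a - b\<bar>"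
proof -
  have *: "exp x - exp y \<le> exp C * \<bar>x - y\<bar>" if "\<bar>x\<bar> \<le> C" for x y :: real
  proof -
    have "exp x * (1 + (y - x)) \<le> exp x * exp (y - x)"
      by (intro mult_left_mono exp_ge_add_one_self) auto
    then have "exp x - exp y \<le> exp x * (x - y)"
      by (simp add: algebra_simps flip: exp_add)
    also have "\<dots> \<le> exp x * \<bar>x - y\<bar>" by (intro mult_left_mono) auto
    also have "\<dots> \<le> exp C * \<bar>x - y\<bar>" using that by (intro mult_right_mono) auto
    finally show ?thesis .
  qed
  show ?thesis using *[OF assms(1), of b] *[OF assms(2), of a] by (simp add: abs_minus_commute)
qed

text \<open>The linear term has Lipschitz constant 1 in the \<open>L\<^sup>1\<close> distance of
  \<open>J\<close>, the exponential term e^C in that of \<open>P\<close>; hence the factor 1 +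
  e^C.\<close>

lemma entropy_functional_perturb:
  assumes P: "prob_space P" and J: "prob_space J" and sets_J: "sets J = sets P"
    and f: "f \<in> borel_measurable P" "\<And>x. \<bar>f x\<bar> \<le> C"
    and g: "g \<in> borel_measurable P" "\<And>x. \<bar>g x\<bar> \<le> C"
    and e: "0 \<le> e" "(\<integral>\<^sup>+ x. ennreal \<bar>f x - g x\<bar> \<partial>P) \<le> ennreal e"
      "(\<integral>\<^sup>+ x. ennreal \<bar>f x - g x\<bar> \<partial>J) \<le> ennreal e"
  shows "entropy_functional P J f \<le> entropy_functional P J g + (1 + exp C) * e"
proof -
  interpret P: prob_space P by fact
  interpret J: prob_space J by fact
  note [measurable] = f(1) g(1)
  have meas_J: "measurable J borel = measurable P (borel :: real measure)"
    by (rule measurable_cong_sets[OF sets_J refl])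
  have int_P: "integrable P h" "integrable P (\<lambda>x. exp (h x))" and int_J: "integrable J h"
    if [measurable]: "h \<in> borel_measurable P" and h: "\<And>x. \<bar>h x\<bar> \<le> C" for h :: "'a \<Rightarrow> real"
  proof -
    show "integrable P h" by (rule P.integrable_const_bound[of _ C]) (use h in auto)
    show "integrable J h" by (rule J.integrable_const_bound[of _ C]) (use h in \<open>auto simp: meas_J\<close>)
    show "integrable P (\<lambda>x. exp (h x))"
      by (rule P.integrable_const_bound[of _ "exp C"]) (use h abs_le_D1 in \<open>auto\<close>)
  qed
  have bound: "(\<integral>x. \<bar>f x - g x\<bar> \<partial>P) \<le> e" "(\<integral>x. \<bar>f x - g x\<bar> \<partial>J) \<le> e"
    using e by (auto intro: integral_real_bounded)
  have "(\<integral>x. f x \<partial>J) - (\<integral>x. g x \<partial>J) = (\<integral>x. f x - g x \<partial>J)"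
    using int_J[OF f] int_J[OF g] by simp
  also have "\<dots> \<le> (\<integral>x. \<bar>f x - g x\<bar> \<partial>J)"
    using int_J[OF f] int_J[OF g] by (intro integral_mono) auto
  finally have 1: "(\<integral>x. f x \<partial>J) - (\<integral>x. g x \<partial>J) \<le> e" using bound by simp
  have "(\<integral>x. exp (g x) - 1 \<partial>P) - (\<integral>x. exp (f x) - 1 \<partial>P) = (\<integral>x. exp (g x) - exp (f x) \<partial>P)"
    using int_P[OF f] int_P[OF g] by simp
  also have "\<dots> \<le> (\<integral>x. exp C * \<bar>f x - g x\<bar> \<partial>P)"
  proof (intro integral_mono)
    show "exp (g x) - exp (f x) \<le> exp C * \<bar>f x - g x\<bar>" for x
      using exp_Lipschitz_on_bounded[OF f(2) g(2), of x x] by linarith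
  qed (use int_P[OF f] int_P[OF g] in auto)
  also have "\<dots> = exp C * (\<integral>x. \<bar>f x - g x\<bar> \<partial>P)" by simp
  also have "\<dots> \<le> exp C * e" using bound by (intro mult_left_mono) auto
  finally show ?thesis using 1 unfolding entropy_functional_def by (simp add: algebra_simps)
qed

text \<open>The witness is P + J. One approximation in its \<open>L\<^sup>1\<close> norm controls
  the errors under both measures.\<close>

lemma finite_measure_dominating_two:
  assumes P: "finite_measure P" and J: "finite_measure J" and sets_J: "sets J = sets P"
  obtains Q where "finite_measure Q" "sets Q = sets P" "P \<le> Q" "J \<le> Q"
proof -
  interpret P: finite_measure P by fact
  interpret J: finite_measure J by fact
  define Q where "Q = measure_of (space P) (sets P) (\<lambda>A. emeasure P A + emeasure J A)"
  have sets_Q: "sets Q = sets P" and space_Q: "space Q = space P" unfolding Q_def by simp_all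
  have em: "emeasure Q A = emeasure P A + emeasure J A" if "A \<in> sets P" for A
    unfolding Q_def
  proof (rule emeasure_measure_of_sigma[OF _ _ _ that])
    show "positive (sets P) (\<lambda>A. emeasure P A + emeasure J A)" by (simp add: positive_def)
    show "countably_additive (sets P) (\<lambda>A. emeasure P A + emeasure J A)"
    proof (rule countably_additiveI)
      fix A :: "nat \<Rightarrow> _" assume A: "range A \<subseteq> sets P" "disjoint_family A"
      have "(\<Sum>i. emeasure P (A i)) = emeasure P (\<Union>i. A i)" "(\<Sum>i. emeasure J (A i)) = emeasure J (\<Union>i. A i)"
        using A sets_J by (auto intro!: suminf_emeasure)
      then show "(\<Sum>i. emeasure P (A i) + emeasure J (A i)) = emeasure P (\<Union>i. A i) + emeasure J (\<Union>i. A i)"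
        by (subst suminf_add[symmetric]) auto
    qed
  qed (rule sets.sigma_algebra_axioms)
  have space_J: "space J = space P" by (rule sets_eq_imp_space_eq[OF sets_J])
  have "emeasure Q (space Q) \<noteq> \<infinity>"
    using P.emeasure_finite J.emeasure_finite by (simp add: space_Q em ennreal_add_eq_top)
  then have "finite_measure Q" by (rule finite_measureI)
  moreover have "emeasure P A \<le> emeasure Q A" "emeasure J A \<le> emeasure Q A" for A
    using em[of A] sets_Q sets_J by (cases "A \<in> sets P"; simp add: emeasure_notin_sets)+
  then have "P \<le> Q" "J \<le> Q"
    using sets_Q space_Q sets_J space_J by (auto simp: le_measure_iff le_fun_def)
  ultimately show ?thesis using sets_Q that by blast
qed

text \<open>Everything takes place in the supremum formula, where finite and infinite limits need no
  separate treatment: refinement makes the suprema monotone in n, and approximation of each bounded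
  test function shows that their limit misses nothing.\<close>

lemma relative_entropy_distr_tendsto:
  fixes P J :: "'b measure" and N :: "nat \<Rightarrow> 'c measure" and X :: "nat \<Rightarrow> 'b \<Rightarrow> 'c"
  assumes P: "prob_space P" and J: "prob_space J" and sets_J: "sets J = sets P"
    and X: "\<And>n. X n \<in> measurable P (N n)"
    and refine: "\<And>n m. n \<le> m \<Longrightarrow> \<exists>\<phi>\<in>measurable (N m) (N n). \<forall>x\<in>space P. X n x = \<phi> (X m x)"
    and generate: "sets P \<subseteq> sigma_sets (space P) (\<Union>n. (\<lambda>A. X n -` A \<inter> space P) ` sets (N n))"
  shows "(\<lambda>n. relative_entropy (distr P (N n) (X n)) (distr J (N n) (X n))) \<longlonglongrightarrow> relative_entropy P J"
proof -
  interpret P: prob_space P by fact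
  interpret J: prob_space J by fact
  obtain Q where Q: "finite_measure Q" "sets Q = sets P" "P \<le> Q" "J \<le> Q"
    by (rule finite_measure_dominating_two[OF P.finite_measure_axioms J.finite_measure_axioms sets_J]) (rule that)
  have space_Q: "space Q = space P" by (rule sets_eq_imp_space_eq[OF Q(2)])
  have space_J: "space J = space P" by (rule sets_eq_imp_space_eq[OF sets_J])
  have X_Q: "X n \<in> measurable Q (N n)" and X_J: "X n \<in> measurable J (N n)" for n
    using X[of n] measurable_cong_sets[OF Q(2) refl] measurable_cong_sets[OF sets_J refl] by auto
  interpret Q: refining_maps Q N X
    by (intro refining_maps.intro refining_maps_axioms.intro)
       (use Q X_Q refine generate in \<open>auto simp: space_Q\<close>)
  define F where "F n = {h \<in> borel_measurable (N n). bounded (range (h :: 'c \<Rightarrow> real))}" for n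
  define H where "H = {h \<in> borel_measurable P. bounded (range (h :: 'b \<Rightarrow> real))}"
  have comp: "(\<lambda>x. h (X n x)) \<in> H" if "h \<in> F n" for h n
  proof -
    have "range (\<lambda>x. h (X n x)) \<subseteq> range h" by auto
    then show ?thesis
      using that measurable_compose[OF X[of n], of h borel] unfolding H_def F_def by (auto intro: bounded_subset)
  qed
  \<comment> \<open>By change of variables this is the relative entropy of the images under
    \<open>X n\<close>, now written over the fixed pair \<open>P\<close>, \<open>J\<close>, so that
    different n can be compared.\<close>
  define R where "R n = (SUP h\<in>F n. ereal (entropy_functional P J (\<lambda>x. h (X n x))))" for n
  have R: "relative_entropy (distr P (N n) (X n)) (distr J (N n) (X n)) = R n" for n
  proof -
    have "relative_entropy (distr P (N n) (X n)) (distr J (N n) (X n)) =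
      (SUP h\<in>F n. ereal (entropy_functional (distr P (N n) (X n)) (distr J (N n) (X n)) h))"
      using X X_J by (subst relative_entropy_eq_SUP) (auto simp: F_def intro!: P.prob_space_distr J.prob_space_distr)
    also have "\<dots> = R n"
      unfolding R_def
    proof (intro SUP_cong refl)
      fix h assume "h \<in> F n"
      then have [measurable]: "h \<in> borel_measurable (N n)" by (simp add: F_def)
      have [measurable]: "X n \<in> measurable P (N n)" "X n \<in> measurable J (N n)" by (rule X, rule X_J)
      show "ereal (entropy_functional (distr P (N n) (X n)) (distr J (N n) (X n)) h) =
          ereal (entropy_functional P J (\<lambda>x. h (X n x)))"
        unfolding entropy_functional_def by (simp add: integral_distr)
    qed
    finally show ?thesis .
  qed
  have lim: "relative_entropy P J = (SUP h\<in>H. ereal (entropy_functional P J h))"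
    unfolding H_def by (rule relative_entropy_eq_SUP[OF P J sets_J])
  have "incseq R"
  proof (rule monoI)
    fix n m :: nat assume "n \<le> m"
    then obtain \<phi> where \<phi>: "\<phi> \<in> measurable (N m) (N n)" and eq: "\<And>x. x \<in> space P \<Longrightarrow> X n x = \<phi> (X m x)"
      using refine by blast
    show "R n \<le> R m"
      unfolding R_def
    proof (rule SUP_mono)
      fix h assume h: "h \<in> F n"
      have "range (\<lambda>y. h (\<phi> y)) \<subseteq> range h" by auto
      then have "(\<lambda>y. h (\<phi> y)) \<in> F m"
        using h measurable_compose[OF \<phi>, of h borel] unfolding F_def by (auto intro: bounded_subset)
      moreover have "entropy_functional P J (\<lambda>x. h (X n x)) = entropy_functional P J (\<lambda>x. h (\<phi> (X m x)))"
        unfolding entropy_functional_def using eq space_J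
        by (intro arg_cong2[where f="(-)"] Bochner_Integration.integral_cong) auto
      ultimately show "\<exists>k\<in>F m. ereal (entropy_functional P J (\<lambda>x. h (X n x)))
          \<le> ereal (entropy_functional P J (\<lambda>x. k (X m x)))"
        by (intro bexI[of _ "\<lambda>y. h (\<phi> y)"]) auto
    qed
  qed
  then have "R \<longlonglongrightarrow> (SUP n. R n)" by (rule LIMSEQ_SUP)
  moreover have "(SUP n. R n) = relative_entropy P J"
  proof (rule antisym)
    show "(SUP n. R n) \<le> relative_entropy P J"
      unfolding lim R_def by (intro SUP_least SUP_upper comp)
    show "relative_entropy P J \<le> (SUP n. R n)"
      unfolding lim
    proof (rule SUP_least)
      fix f assume "f \<in> H"
      then obtain C where f: "f \<in> borel_measurable P" "\<And>x. \<bar>f x\<bar> \<le> C"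
        by (auto simp: H_def bounded_iff)
      show "ereal (entropy_functional P J f) \<le> (SUP n. R n)"
      proof (rule ereal_le_epsilon2)
        fix e :: real assume e: "0 < e"
        \<comment> \<open>Chosen so that the perturbation error (1 + e^C) d equals e.\<close>
        define d where "d = e / (1 + exp C)"
        have d: "0 < d" "(1 + exp C) * d = e"
          unfolding d_def using e exp_gt_zero[of C] by (auto simp: add_pos_pos less_imp_neq[THEN not_sym])
        have fQ: "f \<in> borel_measurable Q" using f measurable_cong_sets[OF Q(2) refl] by blast
        obtain n h where h: "h \<in> borel_measurable (N n)" "\<And>y. \<bar>h y\<bar> \<le> C"
          and close: "(\<integral>\<^sup>+ x. ennreal \<bar>f x - h (X n x)\<bar> \<partial>Q) < ennreal d"
          using Q.bounded_approximation[OF fQ f(2) d(1)] by blast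
        have hF: "h \<in> F n" using h by (auto simp: F_def bounded_iff)
        have "entropy_functional P J f \<le> entropy_functional P J (\<lambda>x. h (X n x)) + (1 + exp C) * d"
        proof (rule entropy_functional_perturb[OF P J sets_J f])
          show "(\<lambda>x. h (X n x)) \<in> borel_measurable P" by (rule measurable_compose[OF X h(1)])
          show "(\<integral>\<^sup>+ x. ennreal \<bar>f x - h (X n x)\<bar> \<partial>P) \<le> ennreal d"
            using nn_integral_mono_measure[OF Q(2)[symmetric] Q(3)] close by (rule order_trans[OF _ less_imp_le])
          show "(\<integral>\<^sup>+ x. ennreal \<bar>f x - h (X n x)\<bar> \<partial>J) \<le> ennreal d"
            using nn_integral_mono_measure[OF trans[OF sets_J Q(2)[symmetric]] Q(4)] close
            by (rule order_trans[OF _ less_imp_le])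
        qed (use h d in auto)
        then have "ereal (entropy_functional P J f) \<le> ereal (entropy_functional P J (\<lambda>x. h (X n x))) + ereal e"
          unfolding d(2) by simp
        also have "\<dots> \<le> (SUP n. R n) + ereal e"
          unfolding R_def by (intro add_right_mono SUP_upper2[of n] SUP_upper2[OF hF]) auto
        finally show "ereal (entropy_functional P J f) \<le> (SUP n. R n) + ereal e" .
      qed
    qed
  qed
  ultimately show ?thesis unfolding R by simp
qed

section \<open>Sampling of continuous paths\<close>

lemma measurable_path_of:
  assumes "continuous_process M T U"
  shows "path_of T U \<in> measurable M (path_space T)"
  unfolding path_space_def
proof (rule measurable_restrict_space2)
  have U: "U r \<in> borel_measurable M" if "r \<in> {0..T}" for r
    using assms that by (simp add: continuous_process_def)
  then show "path_of T U \<in> measurable M (Pi\<^sub>M {0..T} (\<lambda>_. borel))"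
    unfolding path_of_def by (intro measurable_restrict) auto
  have "continuous_on {0..T} (path_of T U \<omega>) \<longleftrightarrow> continuous_on {0..T} (\<lambda>r. U r \<omega>)" for \<omega>
    unfolding path_of_def by (rule continuous_on_cong) auto
  then show "path_of T U \<in> space M \<rightarrow> {u. continuous_on {0..T} u}"
    using assms by (auto simp: continuous_process_def)
qed

lemma measurable_path_space_eval:
  assumes "r \<in> {0..T}"
  shows "(\<lambda>v. v r) \<in> borel_measurable (path_space T)"
  unfolding path_space_def
  by (rule measurable_restrict_space1) (rule measurable_component_singleton[OF assms])

lemma measurable_sample_vector_path:
  assumes "\<And>i. i \<le> n \<Longrightarrow> s i \<in> {0..T}"
  shows "sample_vector n s (\<lambda>r v. v r) \<in> measurable (path_space T) (Pi\<^sub>M {0..n} (\<lambda>_. borel))"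
  unfolding sample_vector_def using assms
  by (intro measurable_restrict measurable_path_space_eval) auto

lemma measurable_into_path_space:
  assumes "f \<in> space M \<rightarrow> space (path_space T)"
    and "\<And>r. r \<in> {0..T} \<Longrightarrow> (\<lambda>x. f x r) \<in> borel_measurable M"
  shows "f \<in> measurable M (path_space T)"
  unfolding path_space_def
proof (rule measurable_restrict_space2)
  have f: "f x \<in> extensional {0..T}" "continuous_on {0..T} (f x)" if "x \<in> space M" for x
    using assms(1) that by (auto simp: path_space_def space_restrict_space space_PiM PiE_def Pi_iff)
  have "(\<lambda>x. \<lambda>r\<in>{0..T}. f x r) \<in> measurable M (Pi\<^sub>M {0..T} (\<lambda>_. borel))"
    using assms(2) by (intro measurable_restrict) auto
  also have "?this \<longleftrightarrow> f \<in> measurable M (Pi\<^sub>M {0..T} (\<lambda>_. borel))"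
    using f by (intro measurable_cong) (simp add: extensional_restrict)
  finally show "f \<in> measurable M (Pi\<^sub>M {0..T} (\<lambda>_. borel))" .
  show "f \<in> space M \<rightarrow> {u. continuous_on {0..T} u}" using f by auto
qed

text \<open>Take the first grid point that is not before r. Its predecessor lies before r, so the
  distance is at most one step of the grid.\<close>

lemma grid_point_near:
  assumes "1 \<le> n" "s 0 = 0" "s n = T" "s 0 < s 1" "r \<in> {0..T}"
  obtains i where "i \<le> n" "\<bar>s i - r\<bar> \<le> mesh n s"
proof -
  have mesh_ge: "s i - s (i - 1) \<le> mesh n s" if "i \<in> {1..n}" for i
    unfolding mesh_def using that by (intro Max_ge) auto
  define i where "i = (LEAST i. r \<le> s i)"
  have "r \<le> s n" using assms by simp
  then have least: "r \<le> s i" and le: "i \<le> n" unfolding i_def by (rule LeastI, rule Least_le)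
  show ?thesis
  proof (cases "i = 0")
    case True
    \<comment> \<open>Index 0 has no predecessor, but then r is the grid point itself, and the first
      step shows that the mesh is nonnegative.\<close>
    then have "r = 0" using least assms(2,5) by simp
    have "0 \<le> mesh n s" using mesh_ge[of 1] assms by simp
    then show ?thesis using that[of 0] \<open>r = 0\<close> assms(2) by simp
  next
    case False
    then have "\<not> r \<le> s (i - 1)" unfolding i_def by (intro not_less_Least) simp
    then have "\<bar>s i - r\<bar> \<le> s i - s (i - 1)" using least by simp
    then show ?thesis using that[OF le] mesh_ge[of i] False le by force
  qed
qed

text \<open>By path continuity, \<open>v r\<close> is a pointwise limit of sampled values of \<open>v\<close>.\<close>

lemma path_space_generated_by_samples:
  fixes S :: "'s measure" and T :: real and s :: "nat \<Rightarrow> nat \<Rightarrow> real" and d :: "nat \<Rightarrow> nat"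
  defines "\<Omega> \<equiv> S \<Otimes>\<^sub>M path_space T"
    and "X \<equiv> \<lambda>n (u, v). (u, sample_vector (d n) (s n) (\<lambda>r v. v r) v)"
  assumes grid: "\<And>n i. i \<le> d n \<Longrightarrow> s n i \<in> {0..T}"
    and dense: "\<And>r. r \<in> {0..T} \<Longrightarrow> \<exists>i. (\<forall>n. i n \<le> d n) \<and> (\<lambda>n. s n (i n)) \<longlonglongrightarrow> r"
  shows "sets \<Omega> \<subseteq> sigma_sets (space \<Omega>)
    (\<Union>n. (\<lambda>A. X n -` A \<inter> space \<Omega>) ` sets (S \<Otimes>\<^sub>M Pi\<^sub>M {0..d n} (\<lambda>_. borel)))"
proof -
  let ?N = "\<lambda>n. S \<Otimes>\<^sub>M Pi\<^sub>M {0..d n} (\<lambda>_. borel :: real measure)"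
  define G where "G = (\<Union>n. (\<lambda>A. X n -` A \<inter> space \<Omega>) ` sets (?N n))"
  \<comment> \<open>The inclusion of sigma-algebras amounts to measurability of the identity from
    \<open>\<Sigma>\<close> to \<open>\<Omega>\<close>, which can be checked on the two components
    separately.\<close>
  define \<Sigma> where "\<Sigma> = sigma (space \<Omega>) G"
  have G: "G \<subseteq> Pow (space \<Omega>)" unfolding G_def by auto
  have space: "space \<Sigma> = space \<Omega>" and sets: "sets \<Sigma> = sigma_sets (space \<Omega>) G"
    unfolding \<Sigma>_def using G by simp_all
  have in_\<Omega>: "X n p \<in> space (?N n)" if "p \<in> space \<Omega>" for n p
    using that unfolding X_def \<Omega>_def
    by (auto simp: space_pair_measure space_PiM sample_vector_def)
  have X[measurable]: "X n \<in> measurable \<Sigma> (?N n)" for n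
    by (rule measurableI) (auto simp: space sets G_def in_\<Omega>)
  have "fst \<in> measurable \<Sigma> S"
  proof -
    \<comment> \<open>Every observation contains the first component unchanged, so any index would
      do.\<close>
    have "(\<lambda>p. fst (X 0 p)) \<in> measurable \<Sigma> S" by measurable
    then show ?thesis by (simp add: X_def case_prod_beta)
  qed
  moreover have "snd \<in> measurable \<Sigma> (path_space T)"
  proof (rule measurable_into_path_space)
    show "snd \<in> space \<Sigma> \<rightarrow> space (path_space T)"
      by (auto simp: space \<Omega>_def space_pair_measure)
    fix r assume r: "r \<in> {0..T}"
    then obtain i where i: "\<And>n. i n \<le> d n" and lim: "(\<lambda>n. s n (i n)) \<longlonglongrightarrow> r"
      using dense by blast
    have eq: "snd (X n p) (i n) = snd p (s n (i n))" for n p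
      using i by (simp add: X_def sample_vector_def case_prod_beta)
    show "(\<lambda>p. snd p r) \<in> borel_measurable \<Sigma>"
    proof (rule borel_measurable_LIMSEQ_real)
      show "(\<lambda>p. snd p (s n (i n))) \<in> borel_measurable \<Sigma>" for n
      proof -
        have "i n \<in> {0..d n}" using i by simp
        from measurable_component_singleton[OF this]
        have "(\<lambda>w. w (i n)) \<in> borel_measurable (Pi\<^sub>M {0..d n} (\<lambda>_. borel :: real measure))" .
        from measurable_compose[OF measurable_compose[OF X measurable_snd] this]
        show ?thesis by (simp add: eq)
      qed
      fix p assume "p \<in> space \<Sigma>"
      then have "continuous_on {0..T} (snd p)"
        by (auto simp: space \<Omega>_def space_pair_measure path_space_def space_restrict_space)
      then show "(\<lambda>n. snd p (s n (i n))) \<longlonglongrightarrow> snd p r"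
        by (rule continuous_on_tendsto_compose[OF _ lim r]) (use grid i in auto)
    qed
  qed
  ultimately have "(\<lambda>p. p) \<in> measurable \<Sigma> \<Omega>"
    unfolding \<Omega>_def by (intro measurable_pair) (simp_all add: comp_def)
  then have "A \<in> sets \<Sigma>" if "A \<in> sets \<Omega>" for A
    using measurable_sets[of "\<lambda>p. p" \<Sigma> \<Omega> A] that sets.sets_into_space[OF that]
    by (simp add: space Int_absorb2)
  then show ?thesis unfolding sets G_def by blast
qed

section \<open>Application to the channel\<close>

theorem theorem2p1:
  fixes M :: "'a measure"
    and T :: real
    and g :: "real \<Rightarrow> (real \<Rightarrow> real) \<Rightarrow> (real \<Rightarrow> real) \<Rightarrow> real"
    and W B Y :: "real \<Rightarrow> 'a \<Rightarrow> real"
    and t :: "nat \<Rightarrow> nat \<Rightarrow> real"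
  assumes "prob_space M"
    and "T > 0"
    and "standard_brownian_motion M T B"
    and "continuous_process M T W"
    and "prob_space.indep_var M (path_space T) (path_of T W) (path_space T) (path_of T B)"
    and "(\<lambda>(s, u, v). g s u v) \<in> borel_measurable
           (restrict_space borel {0..T} \<Otimes>\<^sub>M path_space T \<Otimes>\<^sub>M path_space T)"
    and "unique_sde_solution M T g W B Y"
    and "\<P>(\<omega> in M. (\<integral>\<^sup>+ s\<in>{0..T}.
           ennreal ((g s (stopped_path T s W \<omega>) (stopped_path T s Y \<omega>))\<^sup>2) \<partial>lborel) < \<infinity>) = 1"
    and "\<P>(\<omega> in M. (\<integral>\<^sup>+ s\<in>{0..T}.
           ennreal ((g s (stopped_path T s W \<omega>) (stopped_path T s B \<omega>))\<^sup>2) \<partial>lborel) < \<infinity>) = 1"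
    and "(\<integral>\<^sup>+ s\<in>{0..T}.
           (\<integral>\<^sup>+ \<omega>. ennreal \<bar>g s (stopped_path T s W \<omega>) (stopped_path T s Y \<omega>)\<bar> \<partial>M) \<partial>lborel) < \<infinity>"
    and "\<And>n. n \<ge> 1 \<Longrightarrow> t n 0 = 0"
    and "\<And>n. n \<ge> 1 \<Longrightarrow> t n n = T"
    and "\<And>n i. n \<ge> 1 \<Longrightarrow> i < n \<Longrightarrow> t n i < t n (Suc i)"
    and "\<And>n. n \<ge> 1 \<Longrightarrow> t n ` {0..n} \<subseteq> t (Suc n) ` {0..Suc n}"
    and "(\<lambda>n. mesh n (t n)) \<longlonglongrightarrow> 0"
  shows "(\<lambda>n. mutual_info M (path_space T) (Pi\<^sub>M {0..n} (\<lambda>_. borel))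
                (path_of T W) (sample_vector n (t n) Y))
           \<longlonglongrightarrow> mutual_info M (path_space T) (path_space T) (path_of T W) (path_of T Y)"
proof -
  interpret prob_space M by fact
  define S where "S = path_space T"
  define R where "R n = Pi\<^sub>M {0..n} (\<lambda>_. borel :: real measure)" for n :: nat
  define smp where "smp n = sample_vector n (t n) (\<lambda>r v. v r)" for n
  define U where "U = path_of T W"
  define V where "V = path_of T Y"
  define P where "P = distr M S U \<Otimes>\<^sub>M distr M S V"
  define J where "J = distr M (S \<Otimes>\<^sub>M S) (\<lambda>\<omega>. (U \<omega>, V \<omega>))"
  \<comment> \<open>The observation keeps the whole message path and samples only the output
    path.\<close>
  define X where "X n = (\<lambda>(u :: real \<Rightarrow> real, v). (u, smp n v))" for n :: nat
  have U[measurable]: "U \<in> measurable M S" unfolding U_def S_def by (rule measurable_path_of) fact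
  have V[measurable]: "V \<in> measurable M S" unfolding V_def S_def
    using assms(7) by (intro measurable_path_of) (simp add: unique_sde_solution_def sde_solution_def)
  have mono: "t n i \<le> t n j" if "1 \<le> n" "i \<le> j" "j \<le> n" for n i j
    using that(2,3)
  proof (induction rule: dec_induct)
    case (step k)
    then show ?case using assms(13)[OF that(1), of k] by simp
  qed simp
  have range: "t n i \<in> {0..T}" if "1 \<le> n" "i \<le> n" for n i
    using mono[of n 0 i] mono[of n i n] assms(11,12)[of n] that by auto
  have smp[measurable]: "smp n \<in> measurable S (R n)" if "1 \<le> n" for n
    unfolding smp_def S_def R_def using range that by (intro measurable_sample_vector_path) auto
  \<comment> \<open>The grid lies in [0,T], where \<open>path_of\<close> agrees with the process, so
    the samples are a function of the path \<open>V\<close>.\<close>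
  have sample: "sample_vector n (t n) Y \<omega> = smp n (V \<omega>)" if "1 \<le> n" for n \<omega>
    using range[OF that] unfolding smp_def V_def sample_vector_def path_of_def by auto
  have nested: "t n ` {0..n} \<subseteq> t m ` {0..m}" if "1 \<le> n" "n \<le> m" for n m
    using that(2,1) by (induction rule: dec_induct) (use assms(14) in \<open>blast, meson order_trans\<close>)
  have P: "prob_space P"
    unfolding P_def by (intro prob_space_pair prob_space_distr U V)
  have J: "prob_space J" unfolding J_def by (rule prob_space_distr) simp
  have sets_P: "sets P = sets (S \<Otimes>\<^sub>M S)" and sets_J: "sets J = sets P"
    unfolding P_def J_def by (simp_all cong: sets_pair_measure_cong)
  have space_P: "space P = space (S \<Otimes>\<^sub>M S)" by (rule sets_eq_imp_space_eq[OF sets_P])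
  have X_S: "X n \<in> measurable (S \<Otimes>\<^sub>M S) (S \<Otimes>\<^sub>M R n)" if "1 \<le> n" for n
    using smp[OF that] unfolding X_def by measurable
  then have X_P: "X n \<in> measurable P (S \<Otimes>\<^sub>M R n)" if "1 \<le> n" for n
    using that measurable_cong_sets[OF sets_P refl] by blast
  \<comment> \<open>The sequence is shifted by one because the assumptions on the grids start at n =
    1.\<close>
  have "(\<lambda>n. relative_entropy (distr P (S \<Otimes>\<^sub>M R (Suc n)) (X (Suc n))) (distr J (S \<Otimes>\<^sub>M R (Suc n)) (X (Suc n))))
      \<longlonglongrightarrow> relative_entropy P J"
  proof (rule relative_entropy_distr_tendsto[OF P J sets_J X_P])
    fix n m :: nat assume "n \<le> m"
    then have "t (Suc n) ` {0..Suc n} \<subseteq> t (Suc m) ` {0..Suc m}" by (intro nested) simp_all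
    then have "\<forall>i\<in>{0..Suc n}. \<exists>j\<in>{0..Suc m}. t (Suc n) i = t (Suc m) j" by blast
    \<comment> \<open>\<open>\<sigma>\<close> locates each point of the coarse grid in the fine one,
      so that coarse samples are a selection of coordinates of the fine samples.\<close>
    then obtain \<sigma> where \<sigma>: "\<And>i. i \<le> Suc n \<Longrightarrow> \<sigma> i \<le> Suc m \<and> t (Suc n) i = t (Suc m) (\<sigma> i)"
      by (metis atLeastAtMost_iff le0)
    define \<phi> where "\<phi> w = (\<lambda>i\<in>{0..Suc n}. w (\<sigma> i))" for w :: "nat \<Rightarrow> real"
    have [measurable]: "\<phi> \<in> measurable (R (Suc m)) (R (Suc n))"
      unfolding \<phi>_def R_def using \<sigma> by (intro measurable_restrict measurable_component_singleton) auto
    have "(\<lambda>(u, w). (u, \<phi> w)) \<in> measurable (S \<Otimes>\<^sub>M R (Suc m)) (S \<Otimes>\<^sub>M R (Suc n))" by measurable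
    moreover have "smp (Suc n) v = \<phi> (smp (Suc m) v)" for v
      using \<sigma> unfolding smp_def \<phi>_def sample_vector_def by (auto simp: fun_eq_iff)
    ultimately show "\<exists>\<phi>\<in>measurable (S \<Otimes>\<^sub>M R (Suc m)) (S \<Otimes>\<^sub>M R (Suc n)).
        \<forall>x\<in>space P. X (Suc n) x = \<phi> (X (Suc m) x)"
      by (intro bexI[of _ "\<lambda>(u, w). (u, \<phi> w)"]) (auto simp: X_def)
  next
    have "\<exists>i. (\<forall>n. i n \<le> Suc n) \<and> (\<lambda>n. t (Suc n) (i n)) \<longlonglongrightarrow> r" if r: "r \<in> {0..T}" for r
    proof -
      have "\<exists>i\<le>Suc n. \<bar>t (Suc n) i - r\<bar> \<le> mesh (Suc n) (t (Suc n))" for n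
      proof (rule grid_point_near[of "Suc n" "t (Suc n)" T r])
        show "t (Suc n) 0 < t (Suc n) 1" using assms(13)[of "Suc n" 0] by simp
      qed (use assms(11,12)[of "Suc n"] r in auto)
      then obtain i where i: "\<And>n. i n \<le> Suc n"
        "\<And>n. \<bar>t (Suc n) (i n) - r\<bar> \<le> mesh (Suc n) (t (Suc n))" by metis
      have "(\<lambda>n. t (Suc n) (i n) - r) \<longlonglongrightarrow> 0"
        by (rule Lim_null_comparison[OF _ LIMSEQ_Suc[OF assms(15)]]) (use i in auto)
      then have "(\<lambda>n. t (Suc n) (i n)) \<longlonglongrightarrow> r" by (simp add: LIM_zero_iff)
      then show ?thesis using i(1) by blast
    qed
    then have "sets (S \<Otimes>\<^sub>M S) \<subseteq> sigma_sets (space (S \<Otimes>\<^sub>M S))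
        (\<Union>n. (\<lambda>A. X (Suc n) -` A \<inter> space (S \<Otimes>\<^sub>M S)) ` sets (S \<Otimes>\<^sub>M R (Suc n)))"
      using path_space_generated_by_samples[of Suc "\<lambda>n. t (Suc n)" T "path_space T"] range
      unfolding X_def smp_def S_def R_def by simp
    then show "sets P \<subseteq> sigma_sets (space P)
        (\<Union>n. (\<lambda>A. X (Suc n) -` A \<inter> space P) ` sets (S \<Otimes>\<^sub>M R (Suc n)))"
      unfolding sets_P space_P .
  qed simp
  moreover have "relative_entropy (distr P (S \<Otimes>\<^sub>M R n) (X n)) (distr J (S \<Otimes>\<^sub>M R n) (X n)) =
      mutual_info M S (R n) U (sample_vector n (t n) Y)" if n: "1 \<le> n" for n
  proof -
    note [measurable] = smp[OF n]
    have V': "sample_vector n (t n) Y = (\<lambda>\<omega>. smp n (V \<omega>))" using sample[OF n] by auto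
    have "distr M (R n) (\<lambda>\<omega>. smp n (V \<omega>)) = distr (distr M S V) (R n) (smp n)"
      by (simp add: distr_distr comp_def)
    \<comment> \<open>\<open>X n\<close> is the product of the identity and \<open>smp n\<close>, so
      it maps the product of the marginal laws to a product again. The first factor is written as an
      image under the identity to fit \<open>pair_measure_distr\<close>.\<close>
    moreover have "distr (distr M S U) S (\<lambda>u. u) = distr M S U" by (rule distr_id2) simp
    moreover have "sigma_finite_measure (distr (distr M S V) (R n) (smp n))"
      by (intro prob_space_imp_sigma_finite prob_space.prob_space_distr[OF prob_space_distr]) simp_all
    ultimately have P': "distr M S U \<Otimes>\<^sub>M distr M (R n) (\<lambda>\<omega>. smp n (V \<omega>)) = distr P (S \<Otimes>\<^sub>M R n) (X n)"
      using pair_measure_distr[of "\<lambda>u. u" "distr M S U" S "smp n" "distr M S V" "R n"]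
      unfolding P_def X_def by simp
    have J': "distr J (S \<Otimes>\<^sub>M R n) (X n) = distr M (S \<Otimes>\<^sub>M R n) (\<lambda>\<omega>. (U \<omega>, smp n (V \<omega>)))"
      unfolding J_def using X_S[OF n] by (subst distr_distr) (simp_all add: comp_def X_def)
    show ?thesis
      unfolding V' by (subst mutual_info_eq_relative_entropy) (simp_all add: P' J')
  qed
  moreover have "mutual_info M S S U V = relative_entropy P J"
    unfolding P_def J_def by (rule mutual_info_eq_relative_entropy) (rule U, rule V)
  ultimately have "(\<lambda>n. mutual_info M S (R (Suc n)) U (sample_vector (Suc n) (t (Suc n)) Y))
      \<longlonglongrightarrow> mutual_info M S S U V" by simp
  then show ?thesis
    unfolding S_def R_def U_def V_def by (rule LIMSEQ_imp_Suc)
qed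

end
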